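(* Let $N\in\mathbb{N}$, let $b_1,\ldots,b_N\in\mathbb{R}$, and let $f=(f_0,f_1,\ldots)$ be a real sequence. Let $v^f_{n,t}$ be the solution of $$v_{n,t+1}+v_{n,t-1}-v_{n+1,t}-v_{n-1,t}+b_nv_{n,t}=0\quad (n=1,\ldots,N,\ t\in\mathbb{N}_0),$$ $$v_{n,-1}=v_{n,0}=0\ (n=1,\ldots,N+1),\qquad v_{0,t}=f_t,\ v_{N+1,t}=0\ (t\in\mathbb{N}_0),$$ and write it in the form $$v^f_{n,t}=\sum_{k=1}^Nc^k_t\varphi^k_n,\qquad n=1,\ldots,N,\ t\in\mathbb{N}_0 .$$ Then the coefficients $c^k$ admit the representation $$c^k=\frac1{\rho_k}T(\lambda_k)*f,\qquad\text{i.e.}\qquad c^k_t=\frac1{\rho_k}\sum_{l=0}^tT_l(\lambda_k)f_{t-l},\qquad t\in\mathbb{N}_0,\ k=1,\ldots,N,$$ where $T_l(2\lambda)$ are the Chebyshev polynomials of the second kind, indexed so that $T_0(\lambda)=0$, $T_1(\lambda)=1$, $T_{l+1}(\lambda)+T_{l-1}(\lambda)-\lambda T_l(\lambda)=0$ for $l\ge1$.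
   Context: $\mathbb{N}=\{1,2,\ldots\}$, $\mathbb{N}_0=\mathbb{N}\cup\{0\}$. $H_N$ is the real symmetric tridiagonal $N\times N$ matrix with diagonal entries $-b_1,\ldots,-b_N$ and all entries on the first sub- and superdiagonals equal to $1$. $\lambda_1,\ldots,\lambda_N$ are its eigenvalues (they are distinct) and $\varphi^k=(\varphi^k_1,\ldots,\varphi^k_N)$ is the eigenvector for $\lambda_k$ normalized by $\varphi^k_1=1$. The numbers $\rho_k$ are defined by $(\varphi^k,\varphi^l)=\delta_{kl}\rho_k$, with $(\cdot,\cdot)$ the standard inner product in $\mathbb{R}^N$. The convolution of sequences is $(a*b)_t=\sum_{s=0}^ta_sb_{t-s}$. *)

theory Defs
  imports "Jordan_Normal_Form.Char_Poly"
begin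

(* Vectors and matrices of Jordan_Normal_Form are indexed from 0, whereas the sequence b and
   the grid variable n below are indexed from 1: component n of a vector x is x $ (n - 1). *)

definition jacobi_mat :: "nat \<Rightarrow> (nat \<Rightarrow> real) \<Rightarrow> real mat" where
  "jacobi_mat N b =
     mat N N (\<lambda>(i, j). if i = j then - b (i + 1)
                      else if i = j + 1 \<or> j = i + 1 then 1 else 0)"

(* Only the values v n t with n \<le> N + 1 and t \<ge> -1 are constrained; the corner value v 0 (-1)
   does not enter. *)

definition is_solution ::
    "nat \<Rightarrow> (nat \<Rightarrow> real) \<Rightarrow> (nat \<Rightarrow> real) \<Rightarrow> (nat \<Rightarrow> int \<Rightarrow> real) \<Rightarrow> bool" where
  "is_solution N b f v \<longleftrightarrow>
     (\<forall>n\<in>{1..N}. \<forall>t::nat.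
        v n (int t + 1) + v n (int t - 1) - v (n + 1) (int t) - v (n - 1) (int t)
          + b n * v n (int t) = 0) \<and>
     (\<forall>n\<in>{1..N+1}. v n (-1) = 0 \<and> v n 0 = 0) \<and>
     (\<forall>t::nat. v 0 (int t) = f t \<and> v (N + 1) (int t) = 0)"

definition is_expansion ::
    "nat \<Rightarrow> (nat \<Rightarrow> real vec) \<Rightarrow> (nat \<Rightarrow> int \<Rightarrow> real) \<Rightarrow> (nat \<Rightarrow> nat \<Rightarrow> real) \<Rightarrow> bool" where
  "is_expansion N \<phi> v c \<longleftrightarrow>
     (\<forall>n\<in>{1..N}. \<forall>t::nat. v n (int t) = (\<Sum>k=1..N. c k t * \<phi> k $ (n - 1)))"

(* Rescaled and shifted Chebyshev polynomials of the second kind: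
   chebT (l + 1) evaluated at 2 * x is the usual U_l(x). *)

fun chebT :: "nat \<Rightarrow> real poly" where
  "chebT 0 = 0"
| "chebT (Suc 0) = 1"
| "chebT (Suc (Suc l)) = [:0, 1:] * chebT (Suc l) - chebT l"

definition convolution :: "(nat \<Rightarrow> real) \<Rightarrow> (nat \<Rightarrow> real) \<Rightarrow> nat \<Rightarrow> real" where
  "convolution a b t = (\<Sum>s=0..t. a s * b (t - s))"

end

theory Submission
  imports Defs
begin

text \<open>
  The idea is to project the initial boundary value problem onto each eigenvector. In terms of
  the vectors \<open>V t = (v 1 t, \<dots>, v N t)\<close> the difference equation reads
  \<open>V (t + 1) + V (t - 1) = H V t + f t e\<close>, where \<open>e\<close> is the first unit vector: the only trace
  of the boundary values is the source term in the first component
  (\<open>jacobi_mat_mult_component\<close>). Since \<open>H\<close> is self-adjoint and \<open>\<phi> k\<close> has first component 1,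
  the scalars \<open>d t = \<phi> k \<bullet> V t\<close> satisfy
  \<open>d (t + 1) + d (t - 1) = lam k * d t + f t\<close> with zero initial data. The sequence
  \<open>T l (lam k)\<close> is the response of this recurrence to a unit impulse, so \<open>d\<close> is its
  convolution with \<open>f\<close> (\<open>driven_recurrence_eq_convolution\<close>).

  It remains to pass between these projections and the coefficients of an expansion.
  Eigenvectors for distinct eigenvalues are orthogonal, so every expansion has
  \<open>d t = rho k * c k t\<close>, which determines \<open>c\<close>. As there are \<open>N\<close> of these orthogonal vectors in
  dimension \<open>N\<close>, the coefficients \<open>d t / rho k\<close> do reconstruct \<open>V t\<close>
  (\<open>orthogonal_family_completeness\<close>), so an expansion exists.
\<close>

lemma jacobi_mat_carrier: "jacobi_mat N b \<in> carrier_mat N N"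
  by (simp add: jacobi_mat_def)

lemma transpose_jacobi_mat: "transpose_mat (jacobi_mat N b) = jacobi_mat N b"
  by (rule eq_matI) (auto simp: jacobi_mat_def)

lemma jacobi_mat_self_adjoint:
  assumes x: "x \<in> carrier_vec N" and y: "y \<in> carrier_vec N"
  shows "x \<bullet> (jacobi_mat N b *\<^sub>v y) = (jacobi_mat N b *\<^sub>v x) \<bullet> y"
  using transpose_vec_mult_scalar[OF jacobi_mat_carrier y x, of b]
  by (simp add: transpose_jacobi_mat)

text \<open>
  The matrix applies the three-term difference operator to a sequence on \<open>0, \<dots>, N + 1\<close> that
  vanishes at the right end; the value at the left end is not seen by the matrix and has to be
  taken out of the first component.
\<close>

lemma jacobi_mat_mult_component:
  fixes x :: "nat \<Rightarrow> real"
  assumes i: "i < N" and right: "x (N + 1) = 0"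
  shows "(jacobi_mat N b *\<^sub>v vec N (\<lambda>j. x (j + 1))) $ i =
           x (i + 2) + x i - b (i + 1) * x (i + 1) - (if i = 0 then x 0 else 0)"
proof -
  have "(jacobi_mat N b *\<^sub>v vec N (\<lambda>j. x (j + 1))) $ i =
      (\<Sum>j = 0..<N. (if i = j then - b (i + 1)
                   else if i = j + 1 \<or> j = i + 1 then 1 else 0) * x (j + 1))"
    using i by (simp add: jacobi_mat_def scalar_prod_def)
  \<comment> \<open>For \<open>i = 0\<close> truncated subtraction turns \<open>i - 1\<close> into a second reference to column 0,
    so the left neighbour is set to 0 explicitly.\<close>
  also have "\<dots> = (\<Sum>j = 0..<N. (if j = i then - b (i + 1) * x (i + 1) else 0)
      + (if j = i - 1 then (if i = 0 then 0 else x i) else 0)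
      + (if j = i + 1 then x (i + 2) else 0))"
    by (rule sum.cong) auto
  also have "\<dots> = - b (i + 1) * x (i + 1) + (if i = 0 then 0 else x i)
      + (if i + 1 < N then x (i + 2) else 0)"
    using i by (simp add: sum.distrib)
  also have "(if i + 1 < N then x (i + 2) else 0) = x (i + 2)"
  proof (cases "i + 1 < N")
    case False
    then have "i + 2 = N + 1" using i by simp
    then show ?thesis using right False by simp
  qed simp
  finally show ?thesis by simp
qed

text \<open>
  Distinct eigenvalues \<open>\<mu>\<close> and \<open>\<nu>\<close> can be told apart by moving the matrix from one factor of
  the inner product to the other: \<open>\<mu> (x \<bullet> y) = \<nu> (x \<bullet> y)\<close>.
\<close>

lemma jacobi_mat_eigenvectors_orthogonal:
  assumes x: "eigenvector (jacobi_mat N b) x \<mu>" and y: "eigenvector (jacobi_mat N b) y \<nu>"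
    and neq: "\<mu> \<noteq> \<nu>"
  shows "x \<bullet> y = 0"
proof -
  have xc: "x \<in> carrier_vec N" and yc: "y \<in> carrier_vec N"
    using x y jacobi_mat_carrier[of N b] by (auto simp: eigenvector_def)
  have "\<nu> * (x \<bullet> y) = x \<bullet> (jacobi_mat N b *\<^sub>v y)"
    using y xc yc by (simp add: eigenvector_def)
  also have "\<dots> = (jacobi_mat N b *\<^sub>v x) \<bullet> y"
    by (rule jacobi_mat_self_adjoint[OF xc yc])
  also have "\<dots> = \<mu> * (x \<bullet> y)"
    using x xc yc by (simp add: eigenvector_def)
  finally show ?thesis using neq by simp
qed

text \<open>
  With the vectors as columns of \<open>P\<close> and their reciprocal square norms on the diagonal of \<open>D\<close>,
  orthogonality says \<open>(D P\<^sup>T) P = 1\<close>. For square matrices a left inverse is a right inverse, and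
  the entries of \<open>P (D P\<^sup>T) = 1\<close> are the claim.
\<close>

lemma orthogonal_family_completeness:
  fixes x :: "nat \<Rightarrow> real vec"
  assumes x: "\<And>k. k < n \<Longrightarrow> x k \<in> carrier_vec n"
    and nonzero: "\<And>k. k < n \<Longrightarrow> x k \<bullet> x k \<noteq> 0"
    and orth: "\<And>k l. k < n \<Longrightarrow> l < n \<Longrightarrow> k \<noteq> l \<Longrightarrow> x k \<bullet> x l = 0"
    and "i < n" "j < n"
  shows "(\<Sum>k<n. x k $ i * x k $ j / (x k \<bullet> x k)) = (if i = j then 1 else 0)"
proof -
  define P where "P = mat n n (\<lambda>(i, k). x k $ i)"
  define Q where "Q = mat n n (\<lambda>(k, i). x k $ i / (x k \<bullet> x k))"
  have P: "P \<in> carrier_mat n n" and Q: "Q \<in> carrier_mat n n"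
    by (simp_all add: P_def Q_def)
  have "Q * P = 1\<^sub>m n"
  proof (rule eq_matI)
    fix k l assume "k < dim_row (1\<^sub>m n)" "l < dim_col (1\<^sub>m n)"
    then have kl: "k < n" "l < n" by auto
    have "(Q * P) $$ (k, l) = (\<Sum>i = 0..<n. x k $ i * x l $ i / (x k \<bullet> x k))"
      using kl by (simp add: P_def Q_def scalar_prod_def)
    also have "\<dots> = (x k \<bullet> x l) / (x k \<bullet> x k)"
      using x[OF kl(2)] by (simp add: scalar_prod_def sum_divide_distrib)
    also have "\<dots> = 1\<^sub>m n $$ (k, l)"
      using kl nonzero orth by simp
    finally show "(Q * P) $$ (k, l) = 1\<^sub>m n $$ (k, l)" .
  qed (simp_all add: P_def Q_def)
  then have "P * Q = 1\<^sub>m n"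
    by (rule mat_mult_left_right_inverse[OF Q P])
  then have "(P * Q) $$ (i, j) = (if i = j then 1 else 0)"
    using assms(4,5) by simp
  moreover have "(P * Q) $$ (i, j) = (\<Sum>k<n. x k $ i * x k $ j / (x k \<bullet> x k))"
    using assms(4,5) by (simp add: P_def Q_def scalar_prod_def atLeast0LessThan)
  ultimately show ?thesis by simp
qed

lemma convolution_chebT_rec:
  "convolution (\<lambda>l. poly (chebT l) z) f (Suc (Suc t)) =
     z * convolution (\<lambda>l. poly (chebT l) z) f (Suc t)
     - convolution (\<lambda>l. poly (chebT l) z) f t + f (Suc t)"
proof -
  let ?T = "\<lambda>l. poly (chebT l) z"
  have shift: "convolution ?T f (Suc m) = (\<Sum>s\<le>m. ?T (Suc s) * f (m - s))" for m
    unfolding convolution_def atLeast0AtMost by (subst sum.atMost_Suc_shift) simp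
  have "convolution ?T f (Suc (Suc t)) = f (Suc t) + (\<Sum>s\<le>t. ?T (Suc (Suc s)) * f (t - s))"
    unfolding shift by (subst sum.atMost_Suc_shift) simp
  also have "(\<Sum>s\<le>t. ?T (Suc (Suc s)) * f (t - s)) =
      z * (\<Sum>s\<le>t. ?T (Suc s) * f (t - s)) - (\<Sum>s\<le>t. ?T s * f (t - s))"
    by (simp add: sum_distrib_left flip: sum_subtractf) (simp add: algebra_simps)
  finally show ?thesis
    by (simp add: shift) (simp add: convolution_def atLeast0AtMost)
qed

text \<open>
  Duhamel's principle for the recurrence that defines \<^const>\<open>chebT\<close>: the sequence
  \<open>poly (chebT l) z\<close> solves it for a unit impulse at time 0. The index of \<open>d\<close> is an integer
  because the initial data are given at the times \<open>-1\<close> and \<open>0\<close>.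
\<close>

lemma driven_recurrence_eq_convolution:
  fixes d :: "int \<Rightarrow> real"
  assumes rec: "\<And>t::nat. d (int t + 1) + d (int t - 1) = z * d (int t) + f t"
    and init: "d (-1) = 0" "d 0 = 0"
  shows "d (int t) = convolution (\<lambda>l. poly (chebT l) z) f t"
proof (induction t rule: induct_nat_012)
  case 0
  then show ?case using init by (simp add: convolution_def)
next
  case 1
  then show ?case using init rec[of 0] by (simp add: convolution_def)
next
  case (ge2 t)
  have "d (int (Suc (Suc t))) + d (int t) = z * d (int (Suc t)) + f (Suc t)"
    using rec[of "Suc t"] by (simp add: algebra_simps)
  then show ?case using ge2 by (simp add: convolution_chebT_rec)
qed

definition state_vec :: "nat \<Rightarrow> (nat \<Rightarrow> int \<Rightarrow> real) \<Rightarrow> int \<Rightarrow> real vec" where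
  "state_vec N v t = vec N (\<lambda>i. v (i + 1) t)"

lemma state_vec_carrier [simp]: "state_vec N v t \<in> carrier_vec N"
  by (simp add: state_vec_def)

lemma state_vec_rec:
  assumes sol: "is_solution N b f v"
  shows "state_vec N v (int t + 1) + state_vec N v (int t - 1) =
           jacobi_mat N b *\<^sub>v state_vec N v (int t) + f t \<cdot>\<^sub>v unit_vec N 0"
proof (rule eq_vecI)
  fix i
  assume "i < dim_vec (jacobi_mat N b *\<^sub>v state_vec N v (int t) + f t \<cdot>\<^sub>v unit_vec N 0)"
  then have i: "i < N" by simp
  have bdry: "v 0 (int t) = f t" "v (N + 1) (int t) = 0"
    using sol by (auto simp: is_solution_def)
  have "i + 1 \<in> {1..N}" using i by simp
  then have "v (i + 1) (int t + 1) + v (i + 1) (int t - 1) - v (i + 1 + 1) (int t)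
      - v (i + 1 - 1) (int t) + b (i + 1) * v (i + 1) (int t) = 0"
    using sol unfolding is_solution_def by blast
  moreover have "(jacobi_mat N b *\<^sub>v state_vec N v (int t)) $ i =
      v (i + 2) (int t) + v i (int t) - b (i + 1) * v (i + 1) (int t)
      - (if i = 0 then f t else 0)"
    unfolding state_vec_def
    using jacobi_mat_mult_component[of i N "\<lambda>n. v n (int t)" b] i bdry by simp
  moreover have "dim_row (jacobi_mat N b) = N"
    using jacobi_mat_carrier by blast
  ultimately show "(state_vec N v (int t + 1) + state_vec N v (int t - 1)) $ i =
      (jacobi_mat N b *\<^sub>v state_vec N v (int t) + f t \<cdot>\<^sub>v unit_vec N 0) $ i"
    using i by (auto simp: state_vec_def)
qed (simp add: state_vec_def)

text \<open>
  Pairing the equation of motion with an eigenvector decouples it: self-adjointness turns the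
  matrix into the scalar \<open>z\<close>, and the normalization \<open>\<psi> $ 0 = 1\<close> makes the boundary source
  act on this mode with amplitude exactly \<open>f t\<close>.
\<close>

lemma eigenvector_projection_eq_convolution:
  assumes sol: "is_solution N b f v" and N: "N \<ge> 1"
    and ev: "eigenvector (jacobi_mat N b) \<psi> z" and one: "\<psi> $ 0 = 1"
  shows "\<psi> \<bullet> state_vec N v (int t) = convolution (\<lambda>l. poly (chebT l) z) f t"
proof (rule driven_recurrence_eq_convolution[where d = "\<lambda>t. \<psi> \<bullet> state_vec N v t"])
  fix t :: nat
  let ?H = "jacobi_mat N b" and ?V = "state_vec N v"
  have \<psi>: "\<psi> \<in> carrier_vec N" and H\<psi>: "?H *\<^sub>v \<psi> = z \<cdot>\<^sub>v \<psi>"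
    using ev jacobi_mat_carrier[of N b] by (auto simp: eigenvector_def)
  have HV: "?H *\<^sub>v ?V (int t) \<in> carrier_vec N"
    using jacobi_mat_carrier state_vec_carrier by (rule mult_mat_vec_carrier)
  have "\<psi> \<bullet> ?V (int t + 1) + \<psi> \<bullet> ?V (int t - 1) = \<psi> \<bullet> (?V (int t + 1) + ?V (int t - 1))"
    using \<psi> by (simp add: scalar_prod_add_distrib[where n = N])
  also have "\<dots> = \<psi> \<bullet> (?H *\<^sub>v ?V (int t)) + \<psi> \<bullet> (f t \<cdot>\<^sub>v unit_vec N 0)"
    using \<psi> HV by (simp add: state_vec_rec[OF sol] scalar_prod_add_distrib[where n = N])
  also have "\<psi> \<bullet> (?H *\<^sub>v ?V (int t)) = z * (\<psi> \<bullet> ?V (int t))"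
    using jacobi_mat_self_adjoint[OF \<psi> state_vec_carrier, of b v "int t"] \<psi> H\<psi>
    by (simp add: smult_scalar_prod_distrib[where n = N])
  also have "\<psi> \<bullet> (f t \<cdot>\<^sub>v unit_vec N 0) = f t"
    using \<psi> N one by (simp add: scalar_prod_smult_distrib[where n = N])
  finally show "\<psi> \<bullet> ?V (int t + 1) + \<psi> \<bullet> ?V (int t - 1) = z * (\<psi> \<bullet> ?V (int t)) + f t" .
next
  have "state_vec N v (-1) = 0\<^sub>v N" "state_vec N v 0 = 0\<^sub>v N"
    using sol by (auto simp: state_vec_def is_solution_def)
  moreover have "\<psi> \<in> carrier_vec N"
    using ev jacobi_mat_carrier[of N b] by (auto simp: eigenvector_def)
  ultimately show "\<psi> \<bullet> state_vec N v (-1) = 0" "\<psi> \<bullet> state_vec N v 0 = 0"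
    by simp_all
qed

theorem proposition2:
  fixes N :: nat and b f lam rho :: "nat \<Rightarrow> real"
    and \<phi> :: "nat \<Rightarrow> real vec" and v :: "nat \<Rightarrow> int \<Rightarrow> real"
  assumes "N \<ge> 1"
    and "bij_betw lam {1..N} {x. eigenvalue (jacobi_mat N b) x}"
    and "\<And>k. k \<in> {1..N} \<Longrightarrow> eigenvector (jacobi_mat N b) (\<phi> k) (lam k)"
    and "\<And>k. k \<in> {1..N} \<Longrightarrow> \<phi> k $ 0 = 1"
    and "\<And>k. k \<in> {1..N} \<Longrightarrow> rho k = \<phi> k \<bullet> \<phi> k"
    and "is_solution N b f v"
  shows "(\<exists>c. is_expansion N \<phi> v c) \<and>
         (\<forall>c. is_expansion N \<phi> v c \<longrightarrow>
            (\<forall>k\<in>{1..N}. \<forall>t.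
               c k t = 1 / rho k * convolution (\<lambda>l. poly (chebT l) (lam k)) f t))"
proof -
  let ?V = "\<lambda>t::nat. state_vec N v (int t)"
  have \<phi>: "\<phi> k \<in> carrier_vec N" and nonzero: "\<phi> k \<bullet> \<phi> k \<noteq> 0" if "k \<in> {1..N}" for k
  proof -
    show *: "\<phi> k \<in> carrier_vec N"
      using assms(3)[OF that] jacobi_mat_carrier[of N b] by (auto simp: eigenvector_def)
    have "\<phi> k \<noteq> 0\<^sub>v N"
      using assms(1) assms(4)[OF that] by auto
    then show "\<phi> k \<bullet> \<phi> k \<noteq> 0"
      using * conjugate_square_eq_0_vec[OF *] by simp
  qed
  have orth: "\<phi> k \<bullet> \<phi> l = 0" if "k \<in> {1..N}" "l \<in> {1..N}" "k \<noteq> l" for k l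
  proof -
    have "lam k \<noteq> lam l"
      using bij_betw_imp_inj_on[OF assms(2)] that by (meson inj_onD)
    then show ?thesis
      by (rule jacobi_mat_eigenvectors_orthogonal[OF assms(3)[OF that(1)] assms(3)[OF that(2)]])
  qed
  have dot: "\<phi> k \<bullet> ?V t = (\<Sum>i<N. \<phi> k $ i * v (i + 1) (int t))" for k t
    by (simp add: state_vec_def scalar_prod_def atLeast0LessThan)
  have "\<exists>c. is_expansion N \<phi> v c"
  proof
    show "is_expansion N \<phi> v (\<lambda>k t. (\<phi> k \<bullet> ?V t) / (\<phi> k \<bullet> \<phi> k))"
      unfolding is_expansion_def
    proof (intro ballI allI)
      fix n t assume n: "n \<in> {1..N}"
      have "(\<Sum>k = 1..N. (\<phi> k \<bullet> ?V t) / (\<phi> k \<bullet> \<phi> k) * \<phi> k $ (n - 1)) =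
          (\<Sum>k = 1..N. \<Sum>i<N. v (i + 1) (int t) * (\<phi> k $ (n - 1) * \<phi> k $ i / (\<phi> k \<bullet> \<phi> k)))"
        unfolding dot by (simp add: sum_divide_distrib sum_distrib_left mult_ac)
      also have "\<dots> = (\<Sum>i<N. v (i + 1) (int t) *
          (\<Sum>k = 1..N. \<phi> k $ (n - 1) * \<phi> k $ i / (\<phi> k \<bullet> \<phi> k)))"
        by (subst sum.swap) (simp add: sum_distrib_left)
      also have "\<dots> = (\<Sum>i<N. v (i + 1) (int t) * (if n - 1 = i then 1 else 0))"
      proof (rule sum.cong)
        fix i assume i: "i \<in> {..<N}"
        have "(\<Sum>k = 1..N. \<phi> k $ (n - 1) * \<phi> k $ i / (\<phi> k \<bullet> \<phi> k)) =
            (\<Sum>k<N. \<phi> (Suc k) $ (n - 1) * \<phi> (Suc k) $ i / (\<phi> (Suc k) \<bullet> \<phi> (Suc k)))"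
          by (simp add: sum.atLeast1_atMost_eq)
        also have "\<dots> = (if n - 1 = i then 1 else 0)"
          using n i \<phi> nonzero orth
          by (intro orthogonal_family_completeness) auto
        finally show "v (i + 1) (int t) * (\<Sum>k = 1..N. \<phi> k $ (n - 1) * \<phi> k $ i / (\<phi> k \<bullet> \<phi> k)) =
            v (i + 1) (int t) * (if n - 1 = i then 1 else 0)" by simp
      qed simp
      also have "\<dots> = v n (int t)"
        using n by (auto simp: if_distrib cong: if_cong)
      finally show "v n (int t) =
          (\<Sum>k = 1..N. (\<phi> k \<bullet> ?V t) / (\<phi> k \<bullet> \<phi> k) * \<phi> k $ (n - 1))" ..
    qed
  qed
  moreover have "c k t = 1 / rho k * convolution (\<lambda>l. poly (chebT l) (lam k)) f t"
    if c: "is_expansion N \<phi> v c" and k: "k \<in> {1..N}" for c k t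
  proof -
    have "\<phi> k \<bullet> ?V t = (\<Sum>i<N. \<phi> k $ i * (\<Sum>l = 1..N. c l t * \<phi> l $ i))"
      unfolding dot using c by (simp add: is_expansion_def)
    also have "\<dots> = (\<Sum>l = 1..N. \<Sum>i<N. c l t * (\<phi> k $ i * \<phi> l $ i))"
      by (subst sum.swap) (simp add: sum_distrib_left mult_ac)
    also have "\<dots> = (\<Sum>l = 1..N. c l t * (\<phi> k \<bullet> \<phi> l))"
      by (intro sum.cong)
        (simp_all add: scalar_prod_def atLeast0LessThan sum_distrib_left carrier_vecD[OF \<phi>])
    also have "\<dots> = (\<Sum>l = 1..N. if l = k then c k t * rho k else 0)"
      using orth k assms(5) by (intro sum.cong) auto
    also have "\<dots> = c k t * rho k"
      using k by simp
    finally show ?thesis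
      using eigenvector_projection_eq_convolution[OF assms(6,1) assms(3)[OF k] assms(4)[OF k], of t]
        nonzero[OF k] assms(5)[OF k]
      by (simp add: field_simps)
  qed
  ultimately show ?thesis by blast
qed

end
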